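(* Let $G=(V,E,w)$ be an $n$-vertex weighted undirected graph with polynomial aspect ratio, and let $k,h\in[n]=\{1,\dots,n\}$. Then there is a distribution $\mathcal{D}$ over pairs $(U,M)$, where $U$ is a dominating ultrametric over $V$ and $M\subseteq V$ (so $M$ is a random variable), such that: 1. Every pair $(U,M)$ in the support of $\mathcal{D}$ has Ramsey hop-distortion $(O(k),M,O(k\cdot\log n),h)$. 2. For every $v\in V$, $\Pr_{(U,M)\sim\mathcal{D}}[v\in M]\ge\Omega(n^{-1/k})$. In addition, for every $\epsilon\in(0,1)$ there is a distribution $\mathcal{D}$ over such pairs such that every $(U,M)$ in the support has Ramsey hop-distortion $\left(O(\frac{\log n}{\epsilon}),M,O(\frac{\log^2 n}{\epsilon}),h\right)$, and for every $v\in V$, $\Pr[v\in M]\ge 1-\epsilon$.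
   Context: Graphs are undirected with finite positive edge weights. For $h\in\mathbb{N}$, $d_G^{(h)}(u,v)$ is the minimum weight of a $u$-$v$ path in $G$ with at most $h$ edges (hops), and $d_G^{(h)}(u,v)=\infty$ if no such path exists. The aspect ratio of $G$ is $\max_{e\in E}w(e)/\min_{e\in E}w(e)$; "polynomial aspect ratio" means it is at most $n^{c}$ for a fixed constant $c$ (constants hidden in $O(\cdot)$ may depend on $c$, and are otherwise universal; logarithmic factors inside $O(\cdot)$ are understood to be at least $1$). An ultrametric is a metric space with $d(x,z)\le\max\{d(x,y),d(y,z)\}$ for all $x,y,z$; equivalently (HST) its points are the leaves of a rooted tree with node labels $\ell\ge0$, where labels are non-increasing from the root to the leaves, are $0$ exactly at the leaves, and the distance between two leaves is the label of their least common ancestor. The value $\infty$ is allowed as a distance/label in the ultrametrics. $U$ is dominating if $d_G(u,v)\le d_U(u,v)$ for all $u,v\in V$. An ultrametric $U$ over $V$ has Ramsey hop-distortion $(t,M,\beta,h)$, where $M\subseteq V$, if $d_G^{(\beta\cdot h)}(u,v)\le d_U(u,v)$ for all $u,v\in V$, and $d_U(u,v)\le t\cdot d_G^{(h)}(u,v)$ for all $u\in M$, $v\in V$. *)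

theory Defs
  imports
    "HOL-Probability.Probability"
    "Graph_Theory.Pair_Digraph"
    "Graph_Theory.Shortest_Path"
begin

text \<open>
  A simple undirected graph is a symmetric loop-free digraph whose arcs are pairs of vertices;
  an edge is represented by its two orientations, which carry the same weight.
\<close>

locale weighted_graph = pair_graph G for G :: "'a pair_pre_digraph" +
  fixes w :: "('a \<times> 'a) weight_fun"
  assumes weight_pos: "e \<in> parcs G \<Longrightarrow> 0 < w e"
    and weight_sym: "(u, v) \<in> parcs G \<Longrightarrow> w (u, v) = w (v, u)"
begin

text \<open>
  The paths between two vertices of a finite graph are finite in number, so the infimum is a
  minimum whenever a path exists; the infimum of the empty set is \<open>\<infinity>\<close>. The unrestricted
  distance is the library's \<open>\<mu> w\<close>.
\<close>

definition hop_dist :: "nat \<Rightarrow> 'a \<Rightarrow> 'a \<Rightarrow> ereal" where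
  "hop_dist h u v = (INF p \<in> {p. apath u p v \<and> length p \<le> h}. ereal (awalk_cost w p))"

definition aspect_ratio :: real where
  "aspect_ratio = Max (w ` parcs G) / Min (w ` parcs G)"

text \<open>The aspect ratio is undefined for an edgeless graph, which meets every bound.\<close>

definition aspect_ratio_le_powr :: "real \<Rightarrow> bool" where
  "aspect_ratio_le_powr c \<longleftrightarrow>
     (parcs G \<noteq> {} \<longrightarrow> aspect_ratio \<le> real (card (pverts G)) powr c)"

definition dominating :: "('a \<Rightarrow> 'a \<Rightarrow> ereal) \<Rightarrow> bool" where
  "dominating U \<longleftrightarrow> (\<forall>u \<in> pverts G. \<forall>v \<in> pverts G. \<mu> w u v \<le> U u v)"

text \<open>
  \<open>\<beta>\<close> is real, and a path has at most \<open>\<beta> h\<close> edges iff it has at most \<open>\<lfloor>\<beta> h\<rfloor>\<close> edges.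
\<close>

definition ramsey_hop_distortion ::
    "('a \<Rightarrow> 'a \<Rightarrow> ereal) \<Rightarrow> real \<Rightarrow> 'a set \<Rightarrow> real \<Rightarrow> nat \<Rightarrow> bool" where
  "ramsey_hop_distortion U t M \<beta> h \<longleftrightarrow>
     M \<subseteq> pverts G \<and>
     (\<forall>u \<in> pverts G. \<forall>v \<in> pverts G. hop_dist (nat \<lfloor>\<beta> * real h\<rfloor>) u v \<le> U u v) \<and>
     (\<forall>u \<in> M. \<forall>v \<in> pverts G. U u v \<le> ereal t * hop_dist h u v)"

end

text \<open>Library metrics are real-valued, whereas here \<open>\<infinity>\<close> is an admissible distance.\<close>

definition ultrametric_on :: "'a set \<Rightarrow> ('a \<Rightarrow> 'a \<Rightarrow> ereal) \<Rightarrow> bool" where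
  "ultrametric_on V d \<longleftrightarrow>
     (\<forall>x \<in> V. \<forall>y \<in> V. 0 \<le> d x y \<and> (d x y = 0 \<longleftrightarrow> x = y) \<and> d x y = d y x) \<and>
     (\<forall>x \<in> V. \<forall>y \<in> V. \<forall>z \<in> V. d x z \<le> max (d x y) (d y z))"

text \<open>Logarithmic factors in asymptotic bounds are understood to be at least 1.\<close>

definition log_factor :: "nat \<Rightarrow> real" where
  "log_factor n = max 1 (ln (real n))"

end

theory Submission
  imports Defs
begin

text \<open>
  At each scale \<open>i\<close>, all vertices are partitioned by a random ordering: a vertex joins the first vertex
  of its hop-constrained ball, of radius randomly chosen among \<open>k\<close> concentric shells of width
  \<open>\<approx> 2\<^sup>i\<close> and \<open>\<approx> h\<close> hops. A vertex \<open>x\<close> is padded, i.e. shares its cluster with all vertices at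
  \<open>h\<close>-hop distance at most \<open>2\<^sup>i\<close>, with probability at least \<open>(|B| / |B'|)\<^bsup>1/k\<^esup>\<close>, where \<open>B\<close> and
  \<open>B'\<close> are the innermost and outermost balls around \<open>x\<close>. The hop bounds add up over the scales
  such that \<open>B'\<close> is the ball \<open>B\<close> of the next scale; hence the probabilities for the independent scales
  multiply to at least \<open>n\<^bsup>-1/k\<^esup>\<close>, at the price of \<open>O(k log n)\<close> times \<open>h\<close> hops, as there are
  \<open>O(log n)\<close> scales. \<open>M\<close> consists of the vertices padded at all scales. The second claim is the case
  \<open>k \<approx> log n / \<epsilon>\<close>, where \<open>n\<^bsup>-1/k\<^esup> \<ge> exp (- \<epsilon>) \<ge> 1 - \<epsilon>\<close>.
\<close>

section \<open>Minimisers of random orderings\<close>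

lemma arg_min_on_eqI:
  fixes f :: "'a \<Rightarrow> 'b :: linorder"
  assumes "inj_on f B" "b \<in> B" "\<And>y. y \<in> B \<Longrightarrow> f b \<le> f y"
  shows "arg_min_on f B = b"
  unfolding arg_min_on_def using assms by (intro arg_min_inj_eq) auto

lemma arg_min_on_subset:
  fixes f :: "'a \<Rightarrow> 'b :: linorder"
  assumes "finite C" "inj_on f C" "B \<subseteq> C" "arg_min_on f C \<in> B"
  shows "arg_min_on f B = arg_min_on f C"
  using assms by (intro arg_min_on_eqI) (auto intro: inj_on_subset arg_min_least)

text \<open>\<open>to_nat_on V\<close> is a fixed injective numbering of \<open>V\<close>; composed
  with a uniformly random permutation it ranks the vertices in uniformly random order. Injectivity
  makes minimisers unique.\<close>

lemma inj_on_rank_permutes: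
  assumes "finite V" "\<sigma> permutes V" "B \<subseteq> V"
  shows "inj_on (to_nat_on V \<circ> \<sigma>) B"
proof (rule comp_inj_on)
  show "inj_on \<sigma> B"
    using assms(2) by (rule permutes_inj_on)
  have "\<sigma> ` B \<subseteq> V"
    using assms(2,3) by (auto simp: permutes_in_image)
  then show "inj_on (to_nat_on V) (\<sigma> ` B)"
    using assms(1) by (meson countable_finite inj_on_subset inj_on_to_nat_on)
qed

text \<open>
  Precomposition with the transposition of \<open>a\<close> and \<open>b\<close> moves the minimiser from \<open>a\<close> to \<open>b\<close>, so all
  elements of \<open>B\<close> are equally likely to be the minimiser.
\<close>

lemma card_permutes_arg_min_on:
  assumes "finite V" "B \<subseteq> V" "b \<in> B"
  shows "card {\<sigma>. \<sigma> permutes V \<and> arg_min_on (to_nat_on V \<circ> \<sigma>) B = b} * card B = fact (card V)"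
proof -
  define N where "N b = {\<sigma>. \<sigma> permutes V \<and> arg_min_on (to_nat_on V \<circ> \<sigma>) B = b}" for b
  have fin: "finite B"
    using assms(2,1) by (rule finite_subset)
  have finN: "finite (N b)" for b
    by (rule finite_subset[OF _ finite_permutations[OF assms(1)]]) (auto simp: N_def)
  have le: "card (N a) \<le> card (N b)" if "a \<in> B" "b \<in> B" for a b
  proof (rule card_inj_on_le)
    let ?t = "Transposition.transpose a b"
    have tB: "?t y \<in> B" if "y \<in> B" for y
      using that \<open>a \<in> B\<close> \<open>b \<in> B\<close> by (auto simp: Transposition.transpose_def)
    show "inj_on (\<lambda>\<sigma>. \<sigma> \<circ> ?t) (N a)"
      by (rule inj_on_inverseI[of _ "\<lambda>\<sigma>. \<sigma> \<circ> ?t"]) (simp add: comp_assoc)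
    show "(\<lambda>\<sigma>. \<sigma> \<circ> ?t) ` N a \<subseteq> N b"
    proof safe
      fix \<sigma> assume \<sigma>: "\<sigma> \<in> N a"
      have perm: "\<sigma> \<circ> ?t permutes V"
        using \<sigma> that assms(2) by (auto simp: N_def intro!: permutes_compose permutes_swap_id)
      have "arg_min_on (to_nat_on V \<circ> (\<sigma> \<circ> ?t)) B = b"
      proof (rule arg_min_on_eqI)
        show "inj_on (to_nat_on V \<circ> (\<sigma> \<circ> ?t)) B"
          using assms perm by (intro inj_on_rank_permutes)
        fix y assume "y \<in> B"
        have "arg_min_on (to_nat_on V \<circ> \<sigma>) B = a"
          using \<sigma> by (simp add: N_def)
        moreover have "(to_nat_on V \<circ> \<sigma>) (arg_min_on (to_nat_on V \<circ> \<sigma>) B) \<le> (to_nat_on V \<circ> \<sigma>) (?t y)"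
          using fin tB[OF \<open>y \<in> B\<close>] by (intro arg_min_least) auto
        ultimately have "(to_nat_on V \<circ> \<sigma>) a \<le> (to_nat_on V \<circ> \<sigma>) (?t y)"
          by simp
        then show "(to_nat_on V \<circ> (\<sigma> \<circ> ?t)) b \<le> (to_nat_on V \<circ> (\<sigma> \<circ> ?t)) y"
          by simp
      qed (fact \<open>b \<in> B\<close>)
      with perm show "\<sigma> \<circ> ?t \<in> N b" by (simp add: N_def)
    qed
  qed (rule finN)
  have "{\<sigma>. \<sigma> permutes V} = (\<Union>a\<in>B. N a)"
  proof -
    have "B \<noteq> {}" using assms(3) by auto
    then show ?thesis
      using arg_min_if_finite(1)[OF fin] by (auto simp: N_def)
  qed
  then have "fact (card V) = card (\<Union>a\<in>B. N a)"
    using card_permutations[OF refl assms(1)] by simp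
  also have "\<dots> = (\<Sum>a\<in>B. card (N a))"
    by (rule card_UN_disjoint) (use fin finN in \<open>auto simp: N_def\<close>)
  also have "\<dots> = (\<Sum>a\<in>B. card (N b))"
    using le assms(3) by (intro sum.cong refl antisym) auto
  finally show ?thesis by (simp add: N_def mult.commute)
qed

lemma card_permutes_arg_min_on_mem:
  assumes "finite V" "B \<subseteq> V" "A \<subseteq> B" "B \<noteq> {}"
  shows "card {\<sigma>. \<sigma> permutes V \<and> arg_min_on (to_nat_on V \<circ> \<sigma>) B \<in> A} =
    fact (card V) * (card A / card B)"
proof -
  let ?N = "\<lambda>b. {\<sigma>. \<sigma> permutes V \<and> arg_min_on (to_nat_on V \<circ> \<sigma>) B = b}"
  have fin: "finite A" "finite B"
    using finite_subset[OF assms(2,1)] finite_subset[OF assms(3)] by auto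
  have N: "card (?N b) = fact (card V) / card B" if "b \<in> A" for b
  proof -
    have "real (card (?N b) * card B) = fact (card V)"
      using that assms by (subst card_permutes_arg_min_on) auto
    then show ?thesis
      using fin assms by (simp add: field_simps)
  qed
  have "{\<sigma>. \<sigma> permutes V \<and> arg_min_on (to_nat_on V \<circ> \<sigma>) B \<in> A} = (\<Union>b\<in>A. ?N b)"
    by auto
  also have "card \<dots> = (\<Sum>b\<in>A. card (?N b))"
    by (rule card_UN_disjoint)
      (use fin finite_permutations[OF assms(1)] in \<open>auto simp: finite_Collect_conjI\<close>)
  also have "real \<dots> = (\<Sum>b\<in>A. fact (card V) / card B)"
    unfolding of_nat_sum using N by (intro sum.cong refl)
  finally show ?thesis
    by simp
qed

section \<open>Random shell and random ordering at a single scale\<close>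

definition scale_pmf :: "'a set \<Rightarrow> nat \<Rightarrow> (nat \<times> ('a \<Rightarrow> 'a)) pmf" where
  "scale_pmf V k = pmf_of_set ({..<k} \<times> {\<sigma>. \<sigma> permutes V})"

lemma set_scale_pmf:
  assumes "finite V" "0 < k"
  shows "set_pmf (scale_pmf V k) = {..<k} \<times> {\<sigma>. \<sigma> permutes V}"
proof -
  have "id \<in> {\<sigma>. \<sigma> permutes V}"
    by (simp add: permutes_id)
  then show ?thesis
    unfolding scale_pmf_def using assms
    by (intro set_pmf_of_set) (auto simp: finite_permutations simp del: mem_Collect_eq)
qed

text \<open>
  The average over \<open>j\<close> of the ratios \<open>|S (2 j)| / |S (2 j + 2)|\<close> is at least their geometric mean,
  whose product telescopes.
\<close>

lemma prob_scale_pmf_ge: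
  assumes "finite V" "0 < k" "mono S" "S 0 \<noteq> {}" "\<And>j. S j \<subseteq> V"
  shows "measure_pmf.prob (scale_pmf V k)
      {(j, \<sigma>). arg_min_on (to_nat_on V \<circ> \<sigma>) (S (2 * j + 2)) \<in> S (2 * j)}
    \<ge> (card (S 0) / card (S (2 * k))) powr (1 / k)"
proof -
  let ?P = "{\<sigma>. \<sigma> permutes V}"
  let ?E = "\<lambda>j. {\<sigma>. \<sigma> permutes V \<and> arg_min_on (to_nat_on V \<circ> \<sigma>) (S (2 * j + 2)) \<in> S (2 * j)}"
  have P_ne: "?P \<noteq> {}"
    using permutes_id by blast
  have S_ne: "S j \<noteq> {}" for j
    using monoD[OF assms(3), of 0 j] assms(4) by blast
  have fin: "finite (S j)" for j
    using assms(5,1) by (rule finite_subset)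
  have pos: "card (S j) > 0" for j
    using S_ne fin by (simp add: card_gt_0_iff)
  have nz: "card (S j) \<noteq> 0" for j
    using pos[of j] by simp
  have E: "card (?E j) = fact (card V) * (card (S (2 * j)) / card (S (2 * j + 2)))" for j
    using assms S_ne monoD[OF assms(3), of "2*j" "2*j+2"]
    by (intro card_permutes_arg_min_on_mem) auto
  have tele: "(\<Prod>j<k. real (card (S (2 * j))) / card (S (2 * j + 2))) = card (S 0) / card (S (2 * k))"
    using nz by (induction k) simp_all
  have "(card (S 0) / card (S (2 * k))) powr (1 / k)
      = (\<Prod>j<k. (real (card (S (2 * j))) / card (S (2 * j + 2)))) powr (1 / k)"
    by (simp only: tele)
  also have "\<dots> \<le> (\<Sum>j<k. (real (card (S (2 * j))) / card (S (2 * j + 2))) / k)"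
    using arith_geom_mean[of "{..<k}" "\<lambda>j. real (card (S (2 * j))) / card (S (2 * j + 2))"] assms(2)
    by auto
  \<comment> \<open>Each ratio is the share of favourable orderings for one shell \<open>j\<close>,
    so their average is the share of favourable pairs.\<close>
  also have "\<dots> = (\<Sum>j<k. card (?E j)) / (k * fact (card V))"
    by (simp only: of_nat_sum E flip: sum_distrib_left sum_divide_distrib) (simp add: field_simps)
  also have "(\<Sum>j<k. card (?E j)) = card (Sigma {..<k} ?E)"
    using finite_permutations[OF assms(1)]
    by (subst card_SigmaI) (auto simp: finite_Collect_conjI)
  also have "Sigma {..<k} ?E = ({..<k} \<times> ?P) \<inter>
      {(j, \<sigma>). arg_min_on (to_nat_on V \<circ> \<sigma>) (S (2 * j + 2)) \<in> S (2 * j)}"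
    by auto
  also have "real (card \<dots>) / (k * fact (card V)) = measure_pmf.prob (scale_pmf V k)
      {(j, \<sigma>). arg_min_on (to_nat_on V \<circ> \<sigma>) (S (2 * j + 2)) \<in> S (2 * j)}"
    unfolding scale_pmf_def
    using assms(2) P_ne finite_permutations[OF assms(1)] card_permutations[OF refl assms(1)]
    by (subst measure_pmf_of_set) (simp_all add: card_cartesian_product lessThan_empty_iff)
  finally show ?thesis .
qed

section \<open>Ultrametrics from sequences of partitions\<close>

text \<open>
  Points with different centers \<open>P i\<close> at scale \<open>i\<close> are at distance at least \<open>lab (Suc i)\<close>. The maximum
  over all scales is the label of the least common ancestor in the tree of the common refinements
  of the partitions at the scales \<open>\<ge> i\<close>.
\<close>

definition tree_dist :: "(nat \<Rightarrow> 'a \<Rightarrow> 'b) \<Rightarrow> (nat \<Rightarrow> ereal) \<Rightarrow> nat \<Rightarrow> 'a \<Rightarrow> 'a \<Rightarrow> ereal" where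
  "tree_dist P lab L u v =
     (if u = v then 0 else SUP i\<in>{..L}. if P i u = P i v then lab 0 else lab (Suc i))"

lemma tree_dist_upper:
  assumes "u \<noteq> v" "i \<le> L"
  shows "(if P i u = P i v then lab 0 else lab (Suc i)) \<le> tree_dist P lab L u v"
proof -
  have "tree_dist P lab L u v = (SUP i\<in>{..L}. if P i u = P i v then lab 0 else lab (Suc i))"
    using assms(1) by (simp add: tree_dist_def)
  then show ?thesis
    using assms(2) by (metis (no_types, lifting) SUP_upper atMost_iff)
qed

lemma ultrametric_on_tree_dist:
  assumes "mono lab" "0 < lab 0"
  shows "ultrametric_on V (tree_dist P lab L)"
proof -
  let ?t = "\<lambda>i u v. if P i u = P i v then lab 0 else lab (Suc i)"
  have ge: "?t i u v \<le> tree_dist P lab L u v" if "u \<noteq> v" "i \<le> L" for i u v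
    using that by (rule tree_dist_upper)
  have lab: "lab 0 \<le> lab i" for i
    using assms(1) by (simp add: monoD)
  have lab0: "lab 0 \<le> tree_dist P lab L u v" if "u \<noteq> v" for u v
    using ge[OF that, of 0] lab[of 1] by (auto split: if_splits)
  have pos: "0 < tree_dist P lab L u v" if "u \<noteq> v" for u v
    using lab0[OF that] assms(2) by order
  have self: "tree_dist P lab L u u = 0" for u
    by (simp add: tree_dist_def)
  have nn: "0 \<le> tree_dist P lab L u v" for u v
    using pos[of u v] self[of v] by (cases "u = v") auto
  have tri: "tree_dist P lab L x z \<le> max (tree_dist P lab L x y) (tree_dist P lab L y z)" for x y z
  proof (cases "x = y \<or> y = z \<or> x = z")
    case True
    then show ?thesis using nn self by (auto simp: le_max_iff_disj)
  next
    case False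
    have "(SUP i\<in>{..L}. ?t i x z) \<le> max (tree_dist P lab L x y) (tree_dist P lab L y z)"
    proof (rule SUP_least)
      fix i assume "i \<in> {..L}"
      then show "?t i x z \<le> max (tree_dist P lab L x y) (tree_dist P lab L y z)"
        using ge[of x y i] ge[of y z i] lab0[of x y] False
        by (auto simp: le_max_iff_disj split: if_splits)
    qed
    then show ?thesis using False by (simp add: tree_dist_def)
  qed
  have "tree_dist P lab L x y = tree_dist P lab L y x" for x y
    unfolding tree_dist_def by (simp only: eq_commute)
  then show ?thesis
    unfolding ultrametric_on_def using nn pos tri self by (metis order_less_irrefl)
qed

text \<open>Only scales below \<open>i\<close> can separate the points, and by monotonicity each of
  them contributes at most \<open>lab i\<close>.\<close>

lemma tree_dist_le:
  assumes "mono lab" "i \<le> L" "\<And>j. i \<le> j \<Longrightarrow> j \<le> L \<Longrightarrow> P j u = P j v" "0 \<le> lab 0"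
  shows "tree_dist P lab L u v \<le> lab i"
proof -
  have "(if P j u = P j v then lab 0 else lab (Suc j)) \<le> lab i" if "j \<le> L" for j
    using assms that by (cases "i \<le> j") (auto intro: monoD)
  moreover have "0 \<le> lab i"
    using assms(4) monoD[OF assms(1), of 0 i] by simp
  ultimately show ?thesis
    unfolding tree_dist_def by (smt (verit) SUP_least atMost_iff)
qed

text \<open>The highest separating scale decides: one scale above it the points share a center, and
  the distance is at least the label there. If \<open>L\<close> itself separates, that label is
  infinite; if no scale separates, scale 0 serves.\<close>

lemma tree_dist_ge:
  assumes "u \<noteq> v" "mono lab" "lab (Suc L) = \<infinity>"
  obtains "tree_dist P lab L u v = \<infinity>"
  | i where "i \<le> L" "P i u = P i v" "lab i \<le> tree_dist P lab L u v"
proof -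
  let ?t = "\<lambda>i. if P i u = P i v then lab 0 else lab (Suc i)"
  have ge: "?t i \<le> tree_dist P lab L u v" if "i \<le> L" for i
    using assms(1) that by (rule tree_dist_upper)
  define I where "I = {i. i \<le> L \<and> P i u \<noteq> P i v}"
  have fin: "finite I" by (simp add: I_def)
  show thesis
  proof (cases "I = {}")
    case True
    then have "P 0 u = P 0 v" by (auto simp: I_def)
    with ge[of 0] show ?thesis by (intro that(2)[of 0]) auto
  next
    case False
    let ?i = "Max I"
    have i: "?i \<in> I" using fin False by (rule Max_in)
    then have ge': "lab (Suc ?i) \<le> tree_dist P lab L u v"
      using ge[of ?i] by (auto simp: I_def)
    show ?thesis
    proof (cases "?i = L")
      case True
      with ge' assms show ?thesis by (intro that(1)) auto
    next
      case False
      with i have "Suc ?i \<le> L" by (auto simp: I_def)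
      moreover have "Suc ?i \<notin> I"
        using Max_ge[OF fin, of "Suc ?i"] by auto
      ultimately show ?thesis
        using ge' by (intro that(2)[of "Suc ?i"]) (auto simp: I_def)
    qed
  qed
qed

section \<open>Ramsey embeddings of hop-constrained distances\<close>

text \<open>Isolates what the construction needs of hop-constrained distances: hop budgets add up
  along the triangle inequality, and \<open>r\<close> fixes the length unit of the lowest
  scale.\<close>

locale hop_space =
  fixes V :: "'a set" and d :: "nat \<Rightarrow> 'a \<Rightarrow> 'a \<Rightarrow> ereal" and r :: real
  assumes finite_V: "finite V"
    and r_pos: "0 < r"
    and d_self: "u \<in> V \<Longrightarrow> d h u u = 0"
    and d_sym: "u \<in> V \<Longrightarrow> v \<in> V \<Longrightarrow> d h u v = d h v u"
    and d_triangle: "u \<in> V \<Longrightarrow> v \<in> V \<Longrightarrow> x \<in> V \<Longrightarrow> d (a + b) u x \<le> d a u v + d b v x"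
    and d_lower: "u \<in> V \<Longrightarrow> v \<in> V \<Longrightarrow> u \<noteq> v \<Longrightarrow> ereal r \<le> d h u v"
begin

text \<open>Surplus hops are spent staying at \<open>v\<close>, which costs nothing.\<close>

lemma d_antimono:
  assumes "u \<in> V" "v \<in> V" "a \<le> b"
  shows "d b u v \<le> d a u v"
  using d_triangle[of u v v a "b - a"] d_self[of v "b - a"] assms by simp

lemma d_nonneg:
  assumes "u \<in> V" "v \<in> V"
  shows "0 \<le> d h u v"
  using assms d_self[of u h] d_lower[of u v h] r_pos
  by (cases "u = v") (auto intro: order_trans[of 0 "ereal r"])

text \<open>
  At scale \<open>i\<close> there are \<open>2 k\<close> concentric steps, each of \<open>h\<close> hops and length \<open>r 2\<^sup>i\<close>. The offsets are
  chosen such that the last ball of one scale is the first ball of the next (\<open>hball_Suc\<close>).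
\<close>

definition radius :: "nat \<Rightarrow> nat \<Rightarrow> nat \<Rightarrow> real" where
  "radius k i j = r * (2 * real k * (2 ^ i - 1) + real j * 2 ^ i)"

definition hball :: "nat \<Rightarrow> nat \<Rightarrow> nat \<Rightarrow> nat \<Rightarrow> 'a \<Rightarrow> 'a set" where
  "hball h k i j u = {v \<in> V. d ((2 * k * i + j) * h) u v \<le> ereal (radius k i j)}"

lemma radius_Suc: "radius k i (2 * k) = radius k (Suc i) 0"
  by (simp add: radius_def algebra_simps)

lemma hball_Suc: "hball h k i (2 * k) u = hball h k (Suc i) 0 u"
proof -
  have "2 * k * i + 2 * k = 2 * k * Suc i + 0"
    by simp
  then show ?thesis
    unfolding hball_def radius_Suc by (simp only:)
qed

lemma radius_nonneg: "0 \<le> radius k i j"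
  using r_pos by (simp add: radius_def)

lemma hball_subset: "hball h k i j u \<subseteq> V"
  by (auto simp: hball_def)

lemma finite_hball: "finite (hball h k i j u)"
  using finite_V hball_subset by (rule rev_finite_subset)

lemma hball_self: "u \<in> V \<Longrightarrow> u \<in> hball h k i j u"
  using radius_nonneg by (simp add: hball_def d_self)

lemma hball_0: "u \<in> V \<Longrightarrow> hball h k 0 0 u = {u}"
  using d_lower[of u _ 0] r_pos
  by (force simp: hball_def radius_def d_self zero_ereal_def[symmetric] dest: order_trans[of "ereal r"])

text \<open>The detour from \<open>y\<close> through \<open>x\<close> costs \<open>h\<close> hops
  and length \<open>r * 2 ^ i\<close>, which is exactly one step of the index
  \<open>j\<close>.\<close>

lemma hball_step:
  assumes "x \<in> V" "y \<in> V" "d h x y \<le> ereal (r * 2 ^ i)"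
  shows "hball h k i j x \<subseteq> hball h k i (Suc j) y"
proof
  fix v assume "v \<in> hball h k i j x"
  then have v: "v \<in> V" "d ((2 * k * i + j) * h) x v \<le> ereal (radius k i j)"
    by (auto simp: hball_def)
  have "d (h + (2 * k * i + j) * h) y v \<le> d h y x + d ((2 * k * i + j) * h) x v"
    using assms v by (intro d_triangle)
  also have "\<dots> \<le> ereal (r * 2 ^ i) + ereal (radius k i j)"
    using assms v d_sym[of x y h] by (intro add_mono) auto
  also have "\<dots> = ereal (radius k i (Suc j))"
    by (simp add: radius_def algebra_simps)
  finally show "v \<in> hball h k i (Suc j) y"
    using v by (simp add: hball_def algebra_simps)
qed

lemma mono_hball:
  assumes "u \<in> V"
  shows "mono (\<lambda>j. hball h k i j u)"
  using assms hball_step[of u u h i k] r_pos by (simp add: mono_iff_le_Suc d_self)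

text \<open>The odd index puts the ball midway between the balls \<open>2 * j\<close> and
  \<open>2 * j + 2\<close>, leaving one step of slack on either side.\<close>

definition center :: "nat \<Rightarrow> nat \<Rightarrow> (nat \<Rightarrow> nat \<times> ('a \<Rightarrow> 'a)) \<Rightarrow> nat \<Rightarrow> 'a \<Rightarrow> 'a" where
  "center h k \<omega> i u =
     arg_min_on (to_nat_on V \<circ> snd (\<omega> i)) (hball h k i (2 * fst (\<omega> i) + 1) u)"

text \<open>
  If the first vertex of the larger ball lies already in the smaller one, then it is also the first
  vertex of the middle ball of every point within \<open>r 2\<^sup>i\<close> of \<open>x\<close>.
\<close>

definition core :: "nat \<Rightarrow> nat \<Rightarrow> nat \<Rightarrow> (nat \<Rightarrow> nat \<times> ('a \<Rightarrow> 'a)) \<Rightarrow> 'a set" where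
  "core h k L \<omega> = {x \<in> V. \<forall>i\<le>L.
     arg_min_on (to_nat_on V \<circ> snd (\<omega> i)) (hball h k i (2 * fst (\<omega> i) + 2) x)
       \<in> hball h k i (2 * fst (\<omega> i)) x}"

lemma center_core:
  assumes x: "x \<in> core h k L \<omega>" and y: "y \<in> V" and i: "i \<le> L"
    and perm: "snd (\<omega> i) permutes V" and d: "d h x y \<le> ereal (r * 2 ^ i)"
  shows "center h k \<omega> i x = center h k \<omega> i y"
proof -
  let ?j = "2 * fst (\<omega> i)"
  let ?f = "to_nat_on V \<circ> snd (\<omega> i)"
  let ?c = "arg_min_on ?f (hball h k i (?j + 2) x)"
  have xV: "x \<in> V" and c: "?c \<in> hball h k i ?j x"
    using x i by (auto simp: core_def)
  \<comment> \<open>Applied to both \<open>x\<close> and \<open>y\<close>: the middle ball of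
    \<open>z\<close> contains the inner ball of \<open>x\<close>, hence \<open>?c\<close>, and lies
    in the outer ball of \<open>x\<close>, over which \<open>?c\<close> is minimal.\<close>
  have eq: "center h k \<omega> i z = ?c" if z: "z \<in> V" "d h x z \<le> ereal (r * 2 ^ i)" for z
  proof -
    have "d h z x \<le> ereal (r * 2 ^ i)"
      using z xV d_sym[of x z h] by simp
    then have "hball h k i (?j + 1) z \<subseteq> hball h k i (?j + 2) x"
      using hball_step[of z x h i k "?j + 1"] z xV by simp
    moreover have "?c \<in> hball h k i (?j + 1) z"
      using hball_step[of x z h i k ?j] z xV c by auto
    ultimately show ?thesis
      unfolding center_def using finite_V perm
      by (intro arg_min_on_subset finite_hball inj_on_rank_permutes hball_subset) auto
  qed
  from eq[of x] eq[of y] show ?thesis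
    using xV y d r_pos by (simp add: d_self)
qed

text \<open>Twice the outermost radius at scale \<open>i\<close> is
  \<open>r * (8 * k * 2 ^ i - 4 * k)\<close>, which this rounds up. Points separated at the top
  scale \<open>L\<close> are put at distance \<infinity>.\<close>

definition label :: "nat \<Rightarrow> nat \<Rightarrow> nat \<Rightarrow> ereal" where
  "label k L i = (if i \<le> L then ereal (8 * k * (r * 2 ^ i)) else \<infinity>)"

lemma mono_label: "mono (label k L)"
  unfolding label_def using r_pos by (auto intro!: monoI mult_left_mono power_increasing)

text \<open>Both points reach the common center inside their outermost balls. Going through it
  doubles the radius and the hops \<open>2 * k * (i + 1) * h\<close>, where \<open>i\<close> is at
  most \<open>L\<close>.\<close>

lemma d_le_label:
  assumes uv: "u \<in> V" "v \<in> V" and i: "i \<le> L" and j: "fst (\<omega> i) < k"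
    and eq: "center h k \<omega> i u = center h k \<omega> i v"
  shows "d (4 * k * (L + 1) * h) u v \<le> label k L i"
proof -
  let ?c = "center h k \<omega> i u"
  have c: "center h k \<omega> i z \<in> hball h k i (2 * k) z" if "z \<in> V" for z
  proof -
    have "center h k \<omega> i z \<in> hball h k i (2 * fst (\<omega> i) + 1) z"
      unfolding center_def using hball_self[OF that]
      by (intro arg_min_if_finite finite_hball) blast
    also have "\<dots> \<subseteq> hball h k i (2 * k) z"
      using mono_hball[OF that, of h k i] j monoD[of _ "2 * fst (\<omega> i) + 1" "2 * k"] by fastforce
    finally show ?thesis .
  qed
  let ?H = "(2 * k * i + 2 * k) * h"
  have cV: "?c \<in> V" and cu: "d ?H u ?c \<le> ereal (radius k i (2 * k))"
    and cv: "d ?H v ?c \<le> ereal (radius k i (2 * k))"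
    using c[of u] c[of v] uv eq by (auto simp: hball_def)
  have "2 * k * i + 2 * k \<le> 2 * k * (L + 1)"
    using i by simp
  then have "?H + ?H \<le> 4 * k * (L + 1) * h"
    using mult_le_mono1[of "2 * k * i + 2 * k" "2 * k * (L + 1)" "2 * h"] by (simp add: algebra_simps)
  then have "d (4 * k * (L + 1) * h) u v \<le> d (?H + ?H) u v"
    using uv by (intro d_antimono)
  also have "\<dots> \<le> d ?H u ?c + d ?H ?c v"
    using uv cV by (intro d_triangle)
  also have "\<dots> \<le> ereal (radius k i (2 * k)) + ereal (radius k i (2 * k))"
    using cu cv d_sym[of ?c v] uv cV by (intro add_mono) auto
  also have "\<dots> \<le> label k L i"
    using r_pos i by (simp add: radius_def label_def algebra_simps)
  finally show ?thesis .
qed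

lemma d_le_tree_dist:
  assumes "u \<in> V" "v \<in> V" "\<And>i. i \<le> L \<Longrightarrow> fst (\<omega> i) < k"
  shows "d (4 * k * (L + 1) * h) u v \<le> tree_dist (center h k \<omega>) (label k L) L u v"
proof (cases "u = v")
  case True
  then show ?thesis using assms by (simp add: d_self tree_dist_def)
next
  case False
  have "label k L (Suc L) = \<infinity>"
    by (simp add: label_def)
  with False mono_label show ?thesis
  proof (cases rule: tree_dist_ge[where P = "center h k \<omega>"])
    case (2 i)
    then show ?thesis
      using d_le_label[of u v i L \<omega> k h] assms by auto
  qed simp
qed

lemma tree_dist_le_d:
  assumes x: "x \<in> core h k L \<omega>" and y: "y \<in> V" and k: "0 < k"
    and perm: "\<And>i. i \<le> L \<Longrightarrow> snd (\<omega> i) permutes V"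
    and bound: "d h x y \<noteq> \<infinity> \<Longrightarrow> d h x y \<le> ereal (r * 2 ^ L)"
  shows "tree_dist (center h k \<omega>) (label k L) L x y \<le> ereal (16 * real k) * d h x y"
proof (cases "x = y \<or> d h x y = \<infinity>")
  case True
  have "x \<in> V" using x by (simp add: core_def)
  then show ?thesis using True k by (auto simp: d_self tree_dist_def)
next
  case False
  have xV: "x \<in> V" using x by (simp add: core_def)
  then have ge: "ereal r \<le> d h x y"
    using d_lower y False by blast
  obtain D where D: "d h x y = ereal D"
    using False ge by (cases "d h x y") auto
  \<comment> \<open>From the first scale whose unit length reaches \<open>D\<close> on, the core
    vertex \<open>x\<close> is never separated from \<open>y\<close>. Minimality, or
    \<open>r \<le> D\<close> if \<open>i = 0\<close>, gives \<open>r * 2 ^ i \<le> 2 * D\<close>,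
    which turns the factor 8 of \<open>label\<close> into 16.\<close>
  define i where "i = (LEAST i. D \<le> r * 2 ^ i)"
  have L: "D \<le> r * 2 ^ L"
    using bound False D by simp
  have i: "D \<le> r * 2 ^ i" "i \<le> L"
    unfolding i_def using L by (rule LeastI, rule Least_le)
  have close: "d h x y \<le> ereal (r * 2 ^ j)" if "i \<le> j" for j
  proof -
    have "r * 2 ^ i \<le> r * (2 ^ j :: real)"
      using that r_pos by (intro mult_left_mono power_increasing) auto
    then show ?thesis using i D by simp
  qed
  have D_ge: "r * 2 ^ i \<le> 2 * D"
  proof (cases i)
    case 0
    then show ?thesis using ge D r_pos by simp
  next
    case (Suc i')
    then have "\<not> D \<le> r * 2 ^ i'"
      using not_less_Least[of i' "\<lambda>i. D \<le> r * 2 ^ i"] by (simp add: i_def)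
    then show ?thesis using Suc by simp
  qed
  have "tree_dist (center h k \<omega>) (label k L) L x y \<le> label k L i"
  proof (rule tree_dist_le[OF mono_label i(2)])
    fix j assume "i \<le> j" "j \<le> L"
    then show "center h k \<omega> j x = center h k \<omega> j y"
      using x y perm close by (intro center_core[of _ _ _ L]) auto
  next
    show "0 \<le> label k L 0"
      using r_pos by (simp add: label_def)
  qed
  also have "\<dots> \<le> ereal (16 * real k) * d h x y"
    using i(2) D D_ge mult_left_mono[OF D_ge, of "8 * real k"] by (simp add: label_def)
  finally show ?thesis .
qed

section \<open>Probability of being padded at all scales\<close>

lemma prob_core_ge:
  assumes x: "x \<in> V" and k: "0 < k"
  shows "measure_pmf.prob (Pi_pmf {..L} undefined (\<lambda>_. scale_pmf V k)) {\<omega>. x \<in> core h k L \<omega>}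
    \<ge> real (card V) powr (- 1 / k)"
proof -
  define E where "E i = {(j, \<sigma>). arg_min_on (to_nat_on V \<circ> \<sigma>) (hball h k i (2 * j + 2) x)
    \<in> hball h k i (2 * j) x}" for i
  define b where "b i = real (card (hball h k i 0 x))" for i
  have b_pos: "0 < b i" for i
    using hball_self[OF x, of h k i 0] finite_hball[of h k i 0 x]
    unfolding b_def by (auto simp: card_gt_0_iff)
  have "b (Suc L) \<le> card V"
    unfolding b_def using finite_V hball_subset by (simp add: card_mono)
  then have "real (card V) powr (- 1 / k) \<le> b (Suc L) powr (- 1 / k)"
    using b_pos by (intro powr_mono2') auto
  also have "\<dots> = (1 / b (Suc L)) powr (1 / k)"
    using b_pos[of "Suc L"] by (simp add: powr_minus powr_divide inverse_eq_divide)
  \<comment> \<open>The product telescopes, and \<open>b 0 = 1\<close> because the first ball of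
    scale 0 is a singleton.\<close>
  also have "1 / b (Suc L) = (\<Prod>i\<le>L. b i / b (Suc i))"
  proof -
    have nz: "b i \<noteq> 0" for i using b_pos[of i] by simp
    have "(\<Prod>i\<le>L. b i / b (Suc i)) = b 0 / b (Suc L)"
      by (induction L) (simp_all add: nz)
    then show ?thesis using hball_0[OF x] by (simp add: b_def)
  qed
  also have "\<dots> powr (1 / k) = (\<Prod>i\<le>L. (b i / b (Suc i)) powr (1 / k))"
    by (rule prod_powr_distrib)
  also have "\<dots> \<le> (\<Prod>i\<le>L. measure_pmf.prob (scale_pmf V k) (E i))"
  proof (intro prod_mono conjI)
    fix i
    show "(b i / b (Suc i)) powr (1 / k) \<le> measure_pmf.prob (scale_pmf V k) (E i)"
      \<comment> \<open>The first ball of scale \<open>Suc i\<close> is the last ball of scale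
        \<open>i\<close>, so \<open>b i / b (Suc i)\<close> is the ratio in
        \<open>prob_scale_pmf_ge\<close>.\<close>
      unfolding E_def b_def hball_Suc[symmetric]
      using finite_V k mono_hball[OF x] hball_self[OF x, of h k i 0] hball_subset
      by (intro prob_scale_pmf_ge) auto
  qed simp
  \<comment> \<open>The scales are drawn independently, so the product is the probability of the
    joint event.\<close>
  also have "\<dots> = measure_pmf.prob (Pi_pmf {..L} undefined (\<lambda>_. scale_pmf V k)) (Pi {..L} E)"
    by (simp add: measure_Pi_pmf_Pi)
  also have "Pi {..L} E = {\<omega>. x \<in> core h k L \<omega>}"
    using x by (auto simp: core_def E_def Pi_def split: prod.splits)
  finally show ?thesis .
qed

theorem ramsey_pmf:
  assumes k: "0 < k"
    and bound: "\<And>u v. u \<in> V \<Longrightarrow> v \<in> V \<Longrightarrow> d h u v \<noteq> \<infinity> \<Longrightarrow> d h u v \<le> ereal (r * 2 ^ L)"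
  obtains D :: "(('a \<Rightarrow> 'a \<Rightarrow> ereal) \<times> 'a set) pmf" where
    "\<And>U M. (U, M) \<in> set_pmf D \<Longrightarrow> ultrametric_on V U \<and> M \<subseteq> V \<and>
       (\<forall>u\<in>V. \<forall>v\<in>V. d (4 * k * (L + 1) * h) u v \<le> U u v) \<and>
       (\<forall>u\<in>M. \<forall>v\<in>V. U u v \<le> ereal (16 * real k) * d h u v)"
    "\<And>v. v \<in> V \<Longrightarrow> measure_pmf.prob D {(U, M). v \<in> M} \<ge> real (card V) powr (- 1 / k)"
proof -
  \<comment> \<open>\<open>tree_dist\<close> and \<open>core\<close> read \<omega> at the scales up
    to \<open>L\<close> only, where it is drawn from \<open>scale_pmf\<close>.\<close>
  let ?\<Omega> = "Pi_pmf {..L} undefined (\<lambda>_. scale_pmf V k)"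
  let ?F = "\<lambda>\<omega>. (tree_dist (center h k \<omega>) (label k L) L, core h k L \<omega>)"
  show thesis
  proof (rule that[of "map_pmf ?F ?\<Omega>"])
    fix U M assume "(U, M) \<in> set_pmf (map_pmf ?F ?\<Omega>)"
    then obtain \<omega> where \<omega>: "\<omega> \<in> set_pmf ?\<Omega>" and UM: "(U, M) = ?F \<omega>"
      by auto
    have scale: "fst (\<omega> i) < k" "snd (\<omega> i) permutes V" if "i \<le> L" for i
    proof -
      have "\<omega> i \<in> {..<k} \<times> {\<sigma>. \<sigma> permutes V}"
        using \<omega> that finite_V k by (auto simp: set_Pi_pmf set_scale_pmf PiE_dflt_def)
      then show "fst (\<omega> i) < k" "snd (\<omega> i) permutes V"
        by auto
    qed
    have "0 < label k L 0"
      using k r_pos by (simp add: label_def)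
    moreover have "M \<subseteq> V"
      using UM by (auto simp: core_def)
    moreover have "d (4 * k * (L + 1) * h) u v \<le> U u v" if "u \<in> V" "v \<in> V" for u v
      using d_le_tree_dist[OF that scale(1)] UM by simp
    moreover have "U u v \<le> ereal (16 * real k) * d h u v" if "u \<in> M" "v \<in> V" for u v
      using tree_dist_le_d[of u h k L \<omega> v] scale(2) bound[of u v] k that UM \<open>M \<subseteq> V\<close> by auto
    ultimately show "ultrametric_on V U \<and> M \<subseteq> V \<and>
       (\<forall>u\<in>V. \<forall>v\<in>V. d (4 * k * (L + 1) * h) u v \<le> U u v) \<and>
       (\<forall>u\<in>M. \<forall>v\<in>V. U u v \<le> ereal (16 * real k) * d h u v)"
      using UM by (auto intro: ultrametric_on_tree_dist mono_label)
  next
    fix v assume "v \<in> V"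
    then show "measure_pmf.prob (map_pmf ?F ?\<Omega>) {(U, M). v \<in> M} \<ge> real (card V) powr (- 1 / k)"
      using prob_core_ge[OF _ k, of v L h] by (simp add: vimage_def)
  qed
qed

end
section \<open>Hop-constrained distances in graphs\<close>

context weighted_graph
begin

lemma awalk_cost_nonneg: "awalk u p v \<Longrightarrow> 0 \<le> awalk_cost w p"
  by (erule pos_cost_pos_awalk_cost) (simp add: weight_pos less_imp_le)

text \<open>Cutting a cycle out of a walk adds no hops and, as weights are positive, no cost. Hence
  concatenated and reversed walks can be used without first making them paths.\<close>

lemma hop_dist_le_awalk_cost:
  assumes "awalk u p v" "length p \<le> h"
  shows "hop_dist h u v \<le> ereal (awalk_cost w p)"
  using assms
proof (induction rule: awalk_to_apath_induct)
  case (path p)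
  then show ?case
    unfolding hop_dist_def by (intro INF_lower) (simp add: apath_def)
next
  case (decomp p q r s)
  obtain x where "p = q @ r @ s" "awalk x r x"
    using decomp(1-3) by (auto elim: awalk_cyc_decompE)
  moreover have "0 \<le> awalk_cost w r"
    using \<open>awalk x r x\<close> by (rule awalk_cost_nonneg)
  ultimately show ?case
    using decomp(4,5) by (auto intro: order_trans)
qed

lemma hop_dist_attained:
  assumes "hop_dist h u v \<noteq> \<infinity>"
  obtains p where "apath u p v" "length p \<le> h" "hop_dist h u v = ereal (awalk_cost w p)"
proof -
  let ?S = "{p. apath u p v \<and> length p \<le> h}"
  have "?S \<noteq> {}"
  proof
    assume "?S = {}"
    then have "hop_dist h u v = \<infinity>"
      unfolding hop_dist_def by (simp only: image_empty Inf_empty top_ereal_def)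
    with assms show False by simp
  qed
  moreover have "finite ?S"
    using apaths_finite by (auto simp: finite_Collect_conjI)
  ultimately have "hop_dist h u v \<in> (\<lambda>p. ereal (awalk_cost w p)) ` ?S"
    unfolding hop_dist_def by (subst cInf_eq_Min) (auto intro: Min_in)
  then show thesis using that by auto
qed

lemma mu_le_hop_dist: "\<mu> w u v \<le> hop_dist h u v"
  unfolding hop_dist_def
  by (intro INF_greatest) (auto intro: min_cost_le_walk_cost awalkI_apath)

lemma awalk_rev:
  assumes "awalk u p v"
  shows "awalk v (rev (map prod.swap p)) u \<and> awalk_cost w (rev (map prod.swap p)) = awalk_cost w p"
  using assms
proof (induction p arbitrary: u)
  case Nil
  then show ?case by (auto simp: awalk_Nil_iff)
next
  case (Cons e p)
  obtain x y where e: "e = (x, y)" by (cases e)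
  have xy: "(x, y) \<in> parcs G" and u: "u = x" and p: "awalk y p v"
    using Cons.prems by (auto simp: e awalk_Cons_iff)
  have "(y, x) \<in> parcs G"
    using xy pair_sym_arcs by (force simp: symmetric_conv)
  then have "awalk y [(y, x)] x"
    by (auto simp: awalk_simps dest: in_arcsD2)
  then have "awalk v (rev (map prod.swap p) @ [(y, x)]) x"
    using Cons.IH[OF p] by (auto intro: awalk_appendI)
  then show ?case
    using Cons.IH[OF p] weight_sym[OF xy] by (simp add: e u)
qed

lemma hop_dist_sym: "hop_dist h u v = hop_dist h v u"
proof -
  have le: "hop_dist h u v \<le> hop_dist h v u" for u v
  proof (cases "hop_dist h v u = \<infinity>")
    case False
    then obtain p where "apath v p u" "length p \<le> h" "hop_dist h v u = ereal (awalk_cost w p)"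
      by (rule hop_dist_attained)
    then show ?thesis
      using awalk_rev[of v p u] hop_dist_le_awalk_cost[of u "rev (map prod.swap p)" v h]
      by (auto dest: awalkI_apath)
  qed simp
  show ?thesis by (intro antisym le)
qed

lemma hop_dist_triangle: "hop_dist (a + b) u x \<le> hop_dist a u v + hop_dist b v x"
proof (cases "hop_dist a u v = \<infinity> \<or> hop_dist b v x = \<infinity>")
  case True
  have "0 \<le> hop_dist h y z" for h y z
    unfolding hop_dist_def
    by (intro INF_greatest) (auto intro: awalk_cost_nonneg awalkI_apath)
  with True show ?thesis by (auto simp: plus_ereal.simps)
next
  case False
  obtain p where p: "apath u p v" "length p \<le> a" "hop_dist a u v = ereal (awalk_cost w p)"
    using False by (auto elim: hop_dist_attained)
  obtain q where q: "apath v q x" "length q \<le> b" "hop_dist b v x = ereal (awalk_cost w q)"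
    using False by (auto elim: hop_dist_attained)
  have "awalk u (p @ q) x"
    using p(1) q(1) by (intro awalk_appendI[OF awalkI_apath awalkI_apath])
  then show ?thesis
    using hop_dist_le_awalk_cost[of u "p @ q" x "a + b"] p q by simp
qed

section \<open>Weight bounds and the number of scales\<close>

lemma awalk_cost_le:
  assumes "awalk u p v" "\<And>e. e \<in> parcs G \<Longrightarrow> w e \<le> W"
  shows "awalk_cost w p \<le> real (length p) * W"
  using assms(1)
proof (induction p arbitrary: u)
  case (Cons e p)
  have "w e \<le> W" "awalk_cost w p \<le> real (length p) * W"
    using Cons assms(2) by (auto simp: awalk_Cons_iff)
  then show ?case by (simp add: algebra_simps)
qed simp

text \<open>Distinct endpoints force a first edge, and the rest of the path has nonnegative
  cost.\<close>

lemma hop_dist_ge: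
  assumes "u \<noteq> v" "\<And>e. e \<in> parcs G \<Longrightarrow> r \<le> w e"
  shows "ereal r \<le> hop_dist h u v"
  unfolding hop_dist_def
proof (rule INF_greatest)
  fix p assume "p \<in> {p. apath u p v \<and> length p \<le> h}"
  then have p: "awalk u p v" by (auto intro: awalkI_apath)
  then show "ereal r \<le> ereal (awalk_cost w p)"
  proof (cases p)
    case Nil
    then show ?thesis using p assms(1) by (simp add: awalk_Nil_iff)
  next
    case (Cons e q)
    then have "r \<le> w e" "0 \<le> awalk_cost w q"
      using p assms(2) by (auto simp: awalk_Cons_iff intro: awalk_cost_nonneg)
    then show ?thesis by (simp add: Cons)
  qed
qed

lemma hop_space_hop_dist:
  assumes "0 < r" "\<And>e. e \<in> parcs G \<Longrightarrow> r \<le> w e"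
  shows "hop_space (pverts G) hop_dist r"
proof
  fix u h assume "u \<in> pverts G"
  then have "hop_dist h u u \<le> 0"
    using hop_dist_le_awalk_cost[of u "[]" u h] by (simp add: awalk_Nil_iff zero_ereal_def)
  moreover have "0 \<le> hop_dist h u u"
    unfolding hop_dist_def
    by (intro INF_greatest) (auto intro: awalk_cost_nonneg awalkI_apath)
  ultimately show "hop_dist h u u = 0" by (rule antisym)
qed (rule assms(1) pair_finite_verts hop_dist_sym hop_dist_triangle | erule hop_dist_ge[OF _ assms(2)])+

text \<open>\<open>r\<close> is the least weight, and the aspect ratio then bounds the greatest;
  without edges \<open>r = 1\<close> serves. The exponent is raised to \<open>max c 0\<close> so
  that the constants derived from it are positive.\<close>

lemma weight_bounds:
  assumes "aspect_ratio_le_powr c" "0 < card (pverts G)"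
  obtains r where "0 < r" "\<And>e. e \<in> parcs G \<Longrightarrow> r \<le> w e"
    "\<And>e. e \<in> parcs G \<Longrightarrow> w e \<le> r * real (card (pverts G)) powr max c 0"
proof (cases "parcs G = {}")
  case True
  then show thesis by (intro that[of 1]) auto
next
  case False
  let ?r = "Min (w ` parcs G)"
  have fin: "finite (w ` parcs G)" and ne: "w ` parcs G \<noteq> {}"
    using False pair_finite_arcs by auto
  have "0 < ?r"
    using fin ne weight_pos by simp
  show thesis
  proof (rule that[OF \<open>0 < ?r\<close>])
    fix e assume e: "e \<in> parcs G"
    then show "?r \<le> w e"
      using fin by simp
    have "w e \<le> Max (w ` parcs G)"
      using e fin by simp
    also have "\<dots> \<le> ?r * real (card (pverts G)) powr c"
      using assms(1) False \<open>0 < ?r\<close>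
      by (simp add: aspect_ratio_le_powr_def aspect_ratio_def field_simps)
    also have "\<dots> \<le> ?r * real (card (pverts G)) powr max c 0"
      using assms(2) \<open>0 < ?r\<close> by (intro mult_left_mono powr_mono) auto
    finally show "w e \<le> ?r * real (card (pverts G)) powr max c 0" .
  qed
qed

lemma ramsey_hop_pmf:
  assumes c: "aspect_ratio_le_powr c" and h: "h \<in> {1..card (pverts G)}" and k: "0 < k"
  obtains D :: "(('a \<Rightarrow> 'a \<Rightarrow> ereal) \<times> 'a set) pmf" where
    "\<And>U M t \<beta>. \<lbrakk>(U, M) \<in> set_pmf D; 16 * real k \<le> t;
        (4 * (max c 0 + 1) / ln 2 + 8) * (real k * log_factor (card (pverts G))) \<le> \<beta>\<rbrakk> \<Longrightarrow>
      ultrametric_on (pverts G) U \<and> dominating U \<and> M \<subseteq> pverts G \<and> ramsey_hop_distortion U t M \<beta> h"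
    "\<And>v. v \<in> pverts G \<Longrightarrow>
      measure_pmf.prob D {(U, M). v \<in> M} \<ge> real (card (pverts G)) powr (- 1 / k)"
proof -
  let ?n = "card (pverts G)"
  \<comment> \<open>A path of at most \<open>h \<le> ?n\<close> edges, each of weight at most
    \<open>r * ?n powr max c 0\<close>, costs at most \<open>r * ?n powr a\<close>. \<open>L\<close>
    is chosen with \<open>?n powr a \<le> 2 ^ L\<close>, so the top scale covers all finite
    distances.\<close>
  define a where "a = max c 0 + 1"
  define L where "L = nat \<lceil>a * log 2 ?n\<rceil>"
  have n: "1 \<le> real ?n" and a: "1 \<le> a"
    using h by (auto simp: a_def)
  obtain r where r: "0 < r" "\<And>e. e \<in> parcs G \<Longrightarrow> r \<le> w e"
    "\<And>e. e \<in> parcs G \<Longrightarrow> w e \<le> r * real ?n powr max c 0"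
    using weight_bounds[OF c] n by auto
  interpret H: hop_space "pverts G" hop_dist r
    using r(1,2) by (rule hop_space_hop_dist)
  have log_nonneg: "0 \<le> a * log 2 ?n"
    using a n by simp
  have L_ge: "a * log 2 ?n \<le> L" and L_le: "L \<le> a * log 2 ?n + 1"
    unfolding L_def using log_nonneg by (simp_all add: le_of_int_ceiling ceiling_correct)
  have "real ?n powr a \<le> 2 ^ L"
  proof -
    have "real ?n powr a = (2 powr log 2 ?n) powr a"
      using n by simp
    also have "\<dots> = 2 powr (a * log 2 ?n)"
      by (simp only: powr_powr mult.commute)
    also have "\<dots> \<le> 2 powr L"
      using L_ge by simp
    finally show ?thesis by (simp add: powr_realpow)
  qed
  then have powr_L: "r * real ?n powr a \<le> r * 2 ^ L"
    using r(1) by simp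
  have bound: "hop_dist h u v \<le> ereal (r * 2 ^ L)" if fin: "hop_dist h u v \<noteq> \<infinity>" for u v
  proof -
    obtain p where p: "apath u p v" "length p \<le> h" "hop_dist h u v = ereal (awalk_cost w p)"
      using fin by (rule hop_dist_attained)
    have "awalk_cost w p \<le> real (length p) * (r * real ?n powr max c 0)"
      using p r(3) by (intro awalk_cost_le awalkI_apath)
    also have "\<dots> \<le> ?n * (r * real ?n powr max c 0)"
      using p h r(1) by (intro mult_right_mono) auto
    also have "\<dots> = r * real ?n powr a"
      using n by (simp add: a_def powr_add algebra_simps)
    also note powr_L
    finally show ?thesis using p by simp
  qed
  obtain D where D:
    "\<And>U M. (U, M) \<in> set_pmf D \<Longrightarrow> ultrametric_on (pverts G) U \<and> M \<subseteq> pverts G \<and>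
       (\<forall>u\<in>pverts G. \<forall>v\<in>pverts G. hop_dist (4 * k * (L + 1) * h) u v \<le> U u v) \<and>
       (\<forall>u\<in>M. \<forall>v\<in>pverts G. U u v \<le> ereal (16 * real k) * hop_dist h u v)"
    "\<And>v. v \<in> pverts G \<Longrightarrow> measure_pmf.prob D {(U, M). v \<in> M} \<ge> real ?n powr (- 1 / k)"
    using H.ramsey_pmf[OF k, of h L] bound by blast
  show thesis
  proof (rule that[OF _ D(2)])
    fix U M t \<beta>
    assume UM: "(U, M) \<in> set_pmf D" and t: "16 * real k \<le> t"
      and \<beta>: "(4 * (max c 0 + 1) / ln 2 + 8) * (real k * log_factor ?n) \<le> \<beta>"
    note U = D(1)[OF UM]
    have lf: "1 \<le> log_factor ?n" "ln ?n \<le> log_factor ?n"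
      by (auto simp: log_factor_def)
    \<comment> \<open>The 2 comes from the ceiling in \<open>L\<close> and from scale 0. As
      \<open>log_factor\<close> is at least 1 it absorbs this 2, which after multiplication by
      \<open>4 * k\<close> becomes the summand 8 of the constant.\<close>
    have "L + 1 \<le> a / ln 2 * ln ?n + 2"
      using L_le by (simp add: log_def)
    also have "\<dots> \<le> a / ln 2 * log_factor ?n + 2 * log_factor ?n"
      using lf a by (intro add_mono mult_left_mono) auto
    finally have "4 * real k * (L + 1) \<le> 4 * real k * (a / ln 2 * log_factor ?n + 2 * log_factor ?n)"
      by (intro mult_left_mono) auto
    also have "\<dots> = (4 * a / ln 2 + 8) * (real k * log_factor ?n)"
      by (simp add: algebra_simps)
    also have "\<dots> \<le> \<beta>"
      using \<beta> by (simp add: a_def)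
    finally have "real (4 * k * (L + 1) * h) \<le> \<beta> * h"
      using mult_right_mono[of "4 * real k * (L + 1)" \<beta> "real h"] by (simp add: algebra_simps)
    then have "4 * k * (L + 1) * h \<le> nat \<lfloor>\<beta> * h\<rfloor>"
      by (simp only: le_nat_floor)
    then have hop: "hop_dist (nat \<lfloor>\<beta> * h\<rfloor>) u v \<le> U u v" if "u \<in> pverts G" "v \<in> pverts G" for u v
      using U that H.d_antimono order_trans by blast
    have "ereal (16 * real k) * hop_dist h u v \<le> ereal t * hop_dist h u v"
      if "u \<in> pverts G" "v \<in> pverts G" for u v
      using t that by (intro ereal_mult_right_mono H.d_nonneg) auto
    then have "U u v \<le> ereal t * hop_dist h u v" if "u \<in> M" "v \<in> pverts G" for u v
      using U that by (meson order_trans subsetD)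
    moreover have "dominating U"
      unfolding dominating_def using hop mu_le_hop_dist order_trans by blast
    ultimately show "ultrametric_on (pverts G) U \<and> dominating U \<and> M \<subseteq> pverts G \<and>
        ramsey_hop_distortion U t M \<beta> h"
      using U hop unfolding ramsey_hop_distortion_def by blast
  qed
qed

end

section \<open>Constants and choice of \<open>k\<close> for the two claims\<close>

theorem theorem1:
  fixes c :: real
  shows "\<exists>Ct C\<beta> Cp Ct' C\<beta>' :: real. 0 < Ct \<and> 0 < C\<beta> \<and> 0 < Cp \<and> 0 < Ct' \<and> 0 < C\<beta>' \<and>
    (\<forall>(G :: 'a pair_pre_digraph) w n.
       weighted_graph G w \<and> n = card (pverts G) \<and> weighted_graph.aspect_ratio_le_powr G w c \<longrightarrow>
       (\<forall>k \<in> {1..n}. \<forall>h \<in> {1..n}.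
          \<exists>D :: (('a \<Rightarrow> 'a \<Rightarrow> ereal) \<times> 'a set) pmf.
            (\<forall>(U, M) \<in> set_pmf D.
               ultrametric_on (pverts G) U \<and> weighted_graph.dominating G w U \<and> M \<subseteq> pverts G \<and>
               weighted_graph.ramsey_hop_distortion G w U
                 (Ct * real k) M (C\<beta> * (real k * log_factor n)) h) \<and>
            (\<forall>v \<in> pverts G.
               measure_pmf.prob D {(U, M). v \<in> M} \<ge> Cp * real n powr (- 1 / real k))) \<and>
       (\<forall>h \<in> {1..n}. \<forall>\<epsilon>::real. 0 < \<epsilon> \<and> \<epsilon> < 1 \<longrightarrow>
          (\<exists>D :: (('a \<Rightarrow> 'a \<Rightarrow> ereal) \<times> 'a set) pmf.
            (\<forall>(U, M) \<in> set_pmf D.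
               ultrametric_on (pverts G) U \<and> weighted_graph.dominating G w U \<and> M \<subseteq> pverts G \<and>
               weighted_graph.ramsey_hop_distortion G w U
                 (Ct' * (log_factor n / \<epsilon>)) M (C\<beta>' * ((log_factor n)\<^sup>2 / \<epsilon>)) h) \<and>
            (\<forall>v \<in> pverts G. measure_pmf.prob D {(U, M). v \<in> M} \<ge> 1 - \<epsilon>))))"
proof -
  define C\<beta> where "C\<beta> = 4 * (max c 0 + 1) / ln 2 + 8"
  have C\<beta>_pos: "0 < C\<beta>"
    unfolding C\<beta>_def by (intro add_nonneg_pos divide_nonneg_nonneg) auto
  \<comment> \<open>\<open>k\<close> is bounded only from below, since the second claim needs
    \<open>k > n\<close> when \<epsilon> is small.\<close>
  have main: "\<exists>D :: (('a \<Rightarrow> 'a \<Rightarrow> ereal) \<times> 'a set) pmf.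
      (\<forall>(U, M) \<in> set_pmf D.
         ultrametric_on (pverts G) U \<and> weighted_graph.dominating G w U \<and> M \<subseteq> pverts G \<and>
         weighted_graph.ramsey_hop_distortion G w U t M \<beta> h) \<and>
      (\<forall>v \<in> pverts G. measure_pmf.prob D {(U, M). v \<in> M} \<ge> real (card (pverts G)) powr (- 1 / real k))"
    if "weighted_graph G w" "weighted_graph.aspect_ratio_le_powr G w c"
      "h \<in> {1..card (pverts G)}" "0 < k" "16 * real k \<le> t"
      "C\<beta> * (real k * log_factor (card (pverts G))) \<le> \<beta>"
    for G :: "'a pair_pre_digraph" and w h k t \<beta>
    using weighted_graph.ramsey_hop_pmf[OF that(1-4)] that(5,6) unfolding C\<beta>_def
    by (smt (verit) case_prodI2)
  have second: "\<exists>D :: (('a \<Rightarrow> 'a \<Rightarrow> ereal) \<times> 'a set) pmf.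
      (\<forall>(U, M) \<in> set_pmf D.
         ultrametric_on (pverts G) U \<and> weighted_graph.dominating G w U \<and> M \<subseteq> pverts G \<and>
         weighted_graph.ramsey_hop_distortion G w U (32 * (log_factor (card (pverts G)) / \<epsilon>)) M
           (2 * C\<beta> * ((log_factor (card (pverts G)))\<^sup>2 / \<epsilon>)) h) \<and>
      (\<forall>v \<in> pverts G. measure_pmf.prob D {(U, M). v \<in> M} \<ge> 1 - \<epsilon>)"
    if G: "weighted_graph G w" "weighted_graph.aspect_ratio_le_powr G w c"
      and h: "h \<in> {1..card (pverts G)}" and \<epsilon>: "0 < \<epsilon>" "\<epsilon> < 1"
    for G :: "'a pair_pre_digraph" and w h and \<epsilon> :: real
  proof -
    let ?n = "card (pverts G)"
    let ?l = "log_factor ?n"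
    \<comment> \<open>Then \<open>ln ?n \<le> \<epsilon> * k\<close>, which makes the failure
      probability at most \<epsilon>. Since \<open>?l / \<epsilon>\<close> is at least 1, rounding
      up at most doubles it; hence the constants 32 and \<open>2 * C\<beta>\<close>.\<close>
    define k where "k = nat \<lceil>?l / \<epsilon>\<rceil>"
    have l: "1 \<le> ?l" "ln ?n \<le> ?l"
      by (auto simp: log_factor_def)
    then have l\<epsilon>: "1 \<le> ?l / \<epsilon>"
      using \<epsilon> by (simp add: field_simps)
    then have k_ge: "?l / \<epsilon> \<le> k" and k_le: "k \<le> 2 * (?l / \<epsilon>)"
      unfolding k_def by linarith+
    then have k_pos: "0 < k"
      using l\<epsilon> by (cases k) auto
    have "1 - \<epsilon> \<le> exp (- \<epsilon>)"
      using exp_ge_add_one_self[of "- \<epsilon>"] by simp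
    also have "\<dots> \<le> exp (- 1 / k * ln ?n)"
    proof -
      have "ln ?n \<le> \<epsilon> * k"
        using k_ge l(2) \<epsilon> by (simp add: field_simps)
      then show ?thesis
        using k_pos by (simp add: field_simps)
    qed
    also have "\<dots> = real ?n powr (- 1 / k)"
      using h by (simp add: powr_def)
    finally have prob: "1 - \<epsilon> \<le> real ?n powr (- 1 / k)" .
    have "C\<beta> * (k * ?l) \<le> C\<beta> * (2 * (?l / \<epsilon>) * ?l)"
      using k_le l C\<beta>_pos by (intro mult_left_mono mult_right_mono) auto
    then have "C\<beta> * (k * ?l) \<le> 2 * C\<beta> * (?l\<^sup>2 / \<epsilon>)"
      by (simp add: power2_eq_square algebra_simps)
    moreover have "16 * real k \<le> 32 * (?l / \<epsilon>)"
      using k_le by simp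
    ultimately obtain D :: "(('a \<Rightarrow> 'a \<Rightarrow> ereal) \<times> 'a set) pmf" where
      "\<forall>(U, M) \<in> set_pmf D.
         ultrametric_on (pverts G) U \<and> weighted_graph.dominating G w U \<and> M \<subseteq> pverts G \<and>
         weighted_graph.ramsey_hop_distortion G w U (32 * (?l / \<epsilon>)) M (2 * C\<beta> * (?l\<^sup>2 / \<epsilon>)) h"
      "\<forall>v \<in> pverts G. measure_pmf.prob D {(U, M). v \<in> M} \<ge> real ?n powr (- 1 / real k)"
      using main[OF G h k_pos] by blast
    then show ?thesis
      using prob by (intro exI[of _ D]) (auto intro: order_trans)
  qed
  show ?thesis
    \<comment> \<open>The witness 1 for \<open>Cp\<close> reflects that the bound on the probability
      loses no constant factor.\<close>
    by (rule exI[of _ 16], rule exI[of _ C\<beta>], rule exI[of _ 1], rule exI[of _ 32],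
        rule exI[of _ "2 * C\<beta>"], intro conjI allI impI ballI)
      (use C\<beta>_pos main second in \<open>auto simp: mult_1_left\<close>)
qed

end
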